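(* Let $d \ge 2$, and let $b_1, \dots, b_d$ be pairwise relatively prime integers with $1<b_1 < \cdots < b_d$. Let $\mathcal{S}=\{\boldsymbol{x}_0,\boldsymbol{x}_1,\ldots\}$ be the $d$-dimensional Halton sequence in bases $b_1,\dots,b_d$, i.e. $\boldsymbol{x}_n=(\varphi_{b_1}(n),\ldots,\varphi_{b_d}(n))$, and for $N\ge 2$ let $P_N=\{\boldsymbol{x}_0,\ldots,\boldsymbol{x}_{N-1}\}$. Then there exists a constant $c > 0$ such that, for infinitely many $N \in \mathbb{N}$, we have \[ q(P_N) \le \frac{c}{N^{1/d} (\log N)^{1/(d(d-1))}}. \] In particular, $\mathcal{S}$ is not quasi-uniform.
   Context: For an integer $b\ge 2$ and $n=n_0+n_1b+n_2b^2+\cdots\in\mathbb{N}_0$ (base-$b$ digits $n_i\in\{0,\ldots,b-1\}$), the radical inverse is $\varphi_b(n)=\sum_{i\ge 0} n_i b^{-i-1}\in[0,1)$. For a finite point set $P_N=\{\boldsymbol{x}_0,\ldots,\boldsymbol{x}_{N-1}\}\subset[0,1]^d$, the covering radius is $h(P_N)=\sup_{\boldsymbol{x}\in[0,1]^d}\min_{0\le i<N}\|\boldsymbol{x}-\boldsymbol{x}_i\|$ and the separation radius is $q(P_N)=\frac12\min_{0\le i<j<N}\|\boldsymbol{x}_i-\boldsymbol{x}_j\|$, with $\|\cdot\|$ the Euclidean norm. An infinite sequence in $[0,1]^d$ is quasi-uniform if there is $C>0$ with $h(P_N)/q(P_N)\le C$ for all $N\ge 2$, where $P_N$ denotes its first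 $N$ points. *)

theory Defs
  imports "HOL-Analysis.Analysis"
begin

definition radical_inverse :: "nat \<Rightarrow> nat \<Rightarrow> real" where
  "radical_inverse b n = (\<Sum>i. real (n div b ^ i mod b) / real b ^ (i + 1))"

definition halton :: "('d::finite \<Rightarrow> nat) \<Rightarrow> nat \<Rightarrow> real ^ 'd" where
  "halton b n = (\<chi> i. radical_inverse (b i) n)"

text \<open>
  For a sequence \<open>x\<close>, the point set \<open>P\<^sub>N\<close> is the indexed family \<open>x 0, \<dots>, x (N - 1)\<close>,
  so that a repeated point forces the separation radius to be \<open>0\<close>.
  The unit cube is \<open>cbox 0 1\<close>. The covering radius is meant for \<open>N \<ge> 1\<close>, the
  separation radius for \<open>N \<ge> 2\<close>.
\<close>

definition covering_radius :: "(nat \<Rightarrow> real ^ 'd) \<Rightarrow> nat \<Rightarrow> real" where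
  "covering_radius x N = (SUP y\<in>cbox 0 1. Min ((\<lambda>i. dist y (x i)) ` {..<N}))"

definition separation_radius :: "(nat \<Rightarrow> real ^ 'd) \<Rightarrow> nat \<Rightarrow> real" where
  "separation_radius x N = 1 / 2 * Min {dist (x i) (x j) |i j. i < j \<and> j < N}"

text \<open>
  The conjunct \<open>separation_radius x N > 0\<close> is needed because division by zero
  yields \<open>0\<close>: a sequence with a repeated point has infinite mesh ratio and is not
  quasi-uniform.
\<close>

definition quasi_uniform :: "(nat \<Rightarrow> real ^ 'd) \<Rightarrow> bool" where
  "quasi_uniform x \<longleftrightarrow> (\<exists>C>0. \<forall>N\<ge>2. separation_radius x N > 0 \<and>
     covering_radius x N / separation_radius x N \<le> C)"

end

theory Submission
  imports Defs "HOL-Number_Theory.Residues" "HOL-Real_Asymp.Real_Asymp"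
begin

text \<open>
  The points with indices \<open>n\<close> and \<open>n + M\<close> are within \<open>O(b i ^ -l i)\<close> of each other in coordinate
  \<open>i\<close> if \<open>b i ^ l i\<close> divides \<open>M\<close>. Taking \<open>M\<close> to be the product of comparable powers
  \<open>b i ^ l i \<approx> X\<close> gives distance \<open>O(1 / X)\<close> with \<open>X \<approx> M powr (1 / d)\<close>, which is no gain. But
  in one coordinate \<open>k\<close> two points can also be close by lying in adjacent \<open>b k\<close>-adic intervals,
  for which \<open>M\<close> only has to be \<open>b k ^ (l k - a) * (1 + b k)\<close> modulo \<open>b k ^ l k\<close>. If the product
  of the other powers is \<open>1\<close> modulo \<open>b k ^ a\<close>, this saves a factor of order \<open>T = b k ^ a\<close> in \<open>M\<close>.
  The congruence costs only \<open>ln X = O(T ^ (d - 1))\<close>, by simultaneous Diophantine approximation,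
  so the saving is of order \<open>(ln M) powr (1 / (d - 1))\<close>.
  Comparing volumes, the covering radius of \<open>N\<close> points is at least of order \<open>N powr (-1 / d)\<close>,
  so the mesh ratio is unbounded.
\<close>

section \<open>Radical inverses: recursion on digits, congruences and carries\<close>

lemma radical_inverse_summable:
  assumes "b > 1"
  shows "summable (\<lambda>i. real (n div b ^ i mod b) / real b ^ (i + 1))"
proof (rule summable_comparison_test')
  show "summable (\<lambda>i. (1 / real b) ^ i)"
    using assms by (intro summable_geometric) auto
  fix i :: nat
  have "real (n div b ^ i mod b) \<le> real b"
    using assms by (simp add: less_imp_le)
  then show "norm (real (n div b ^ i mod b) / real b ^ (i + 1)) \<le> (1 / real b) ^ i"
    using assms by (simp add: field_simps)
qed

text \<open>Splitting off the first term of the series removes the lowest digit. This recursion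
  drives the digit inductions below.\<close>

lemma radical_inverse_rec:
  assumes "b > 1"
  shows "radical_inverse b n = (real (n mod b) + radical_inverse b (n div b)) / real b"
proof -
  have "radical_inverse b n =
      (\<Sum>i. real (n div b ^ Suc i mod b) / real b ^ (Suc i + 1)) + real (n mod b) / real b"
    unfolding radical_inverse_def
    using suminf_split_head[OF radical_inverse_summable[OF assms, of n]] by simp
  also have "(\<Sum>i. real (n div b ^ Suc i mod b) / real b ^ (Suc i + 1)) =
      (\<Sum>i. real (n div b div b ^ i mod b) / real b ^ (i + 1) / real b)"
    by (simp add: div_mult2_eq mult.commute)
  also have "\<dots> = radical_inverse b (n div b) / real b"
    unfolding radical_inverse_def
    by (rule suminf_divide[OF radical_inverse_summable[OF assms]])
  finally show ?thesis
    by (simp add: add_divide_distrib)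
qed

lemma radical_inverse_digit:
  assumes "b > 1" "r < b"
  shows "radical_inverse b (r + b * m) = (real r + radical_inverse b m) / real b"
  using radical_inverse_rec[of b "r + b * m"] assms by simp

lemma radical_inverse_bounds:
  assumes "b > 1"
  shows "radical_inverse b n \<ge> 0" "radical_inverse b n \<le> 1"
proof -
  show "radical_inverse b n \<ge> 0"
    unfolding radical_inverse_def
    by (intro suminf_nonneg radical_inverse_summable assms) auto
  have z: "radical_inverse b 0 = 0"
    unfolding radical_inverse_def by simp
  show "radical_inverse b n \<le> 1"
  proof (induction n rule: less_induct)
    case (less n)
    show ?case
    proof (cases "n = 0")
      case False
      then have "radical_inverse b (n div b) \<le> 1"
        using assms by (intro less) auto
      moreover have "real (n mod b) \<le> real b - 1"
        using assms mod_less_divisor[of b n] by linarith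
      ultimately show ?thesis
        using assms by (subst radical_inverse_rec[OF assms]) (simp add: field_simps)
    qed (simp add: z)
  qed
qed

lemma radical_inverse_power_mult:
  assumes "b > 1"
  shows "radical_inverse b (b ^ k * m) = radical_inverse b m / real b ^ k"
proof (induction k)
  case (Suc k)
  then show ?case
    using radical_inverse_digit[OF assms, of 0 "b ^ k * m"] assms by (simp add: mult.assoc)
qed simp

lemma radical_inverse_power_minus_one:
  assumes "b > 1"
  shows "radical_inverse b (b ^ k - 1) = 1 - 1 / real b ^ k"
proof (induction k)
  case 0
  then show ?case by (simp add: radical_inverse_def)
next
  case (Suc k)
  have "b \<le> b * b ^ k" using assms by simp
  then have "b ^ Suc k - 1 = (b - 1) + b * (b ^ k - 1)"
    using assms by (simp add: algebra_simps)
  then have "radical_inverse b (b ^ Suc k - 1) =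
      (real (b - 1) + radical_inverse b (b ^ k - 1)) / real b"
    using radical_inverse_digit[OF assms, of "b - 1" "b ^ k - 1"] assms by simp
  then show ?case
    unfolding Suc.IH using assms by (simp add: of_nat_diff diff_divide_distrib)
qed

text \<open>Numbers congruent modulo \<open>b ^ k\<close> share their \<open>k\<close> lowest
  digits, so both values lie in one closed \<open>b\<close>-adic interval of length
  \<open>b ^ -k\<close>. The induction strips one digit at a time.\<close>

lemma radical_inverse_cong:
  assumes "b > 1" "[m = n] (mod b ^ k)"
  shows "\<bar>radical_inverse b m - radical_inverse b n\<bar> \<le> 1 / real b ^ k"
  using assms(2)
proof (induction k arbitrary: m n)
  case 0
  then show ?case
    using radical_inverse_bounds[OF assms(1), of m] radical_inverse_bounds[OF assms(1), of n]
    by simp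
next
  case (Suc k)
  have digit: "m mod b = n mod b"
    using Suc.prems by (metis cong_def cong_modulus_mult_nat power_Suc)
  have "[m div b = n div b] (mod b ^ k)"
    using Suc.prems digit assms(1) unfolding cong_def by (simp add: mod_mult2_eq)
  then have "\<bar>radical_inverse b (m div b) - radical_inverse b (n div b)\<bar> \<le> 1 / real b ^ k"
    by (rule Suc.IH)
  then have "\<bar>radical_inverse b (m div b) - radical_inverse b (n div b)\<bar> / real b
      \<le> 1 / real b ^ k / real b"
    by (rule divide_right_mono) simp
  moreover have "radical_inverse b m - radical_inverse b n =
      (radical_inverse b (m div b) - radical_inverse b (n div b)) / real b"
    by (subst (1 2) radical_inverse_rec[OF assms(1)]) (simp add: digit add_divide_distrib diff_divide_distrib)
  ultimately show ?case
    by (simp add: abs_divide mult.commute)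
qed

text \<open>
  Here \<open>n\<close> has the digits \<open>0, b - 1, \<dots>, b - 1\<close> in the positions \<open>l - a, \<dots>, l - 1\<close>, and adding
  the summand carries through all of them: the two radical inverses are \<open>\<dots>0(b-1)\<dots>(b-1)\<dots>\<close> and
  \<open>\<dots>10\<dots>0\<dots>\<close>, on either side of a common endpoint of two intervals of length \<open>b ^ -l\<close>.
\<close>
lemma radical_inverse_carry:
  assumes "b > 1" "1 \<le> a" "a \<le> l" "[P = 1] (mod b ^ a)" "P \<ge> 1"
  defines "n \<equiv> b ^ l - b ^ (l - a + 1)"
  shows "\<bar>radical_inverse b n - radical_inverse b (n + b ^ (l - a) * (1 + b) * P)\<bar>
           \<le> 2 / real b ^ l"
proof -
  have "b ^ a dvd P - 1"
    using assms(4,5) by (simp add: cong_altdef_nat)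
  then obtain k where "P - 1 = b ^ a * k" ..
  then have P: "P = 1 + b ^ a * k"
    using assms(5) by simp
  obtain c where a: "a = Suc c" using assms(2) by (cases a) auto
  obtain j where l: "l = j + a" using assms(3) by (metis add.commute le_Suc_ex)
  obtain e where e: "b ^ c = 1 + e"
    using le_Suc_ex[OF one_le_power[of b c]] assms(1) by auto
  define r where "r = radical_inverse b (1 + k * (1 + b))"
  have n: "n = b ^ (j + 1) * (b ^ c - 1)"
    unfolding n_def l a by (simp add: diff_mult_distrib2 power_add)
  have n': "n = b ^ j * (b * e)"
    unfolding n e by simp
  \<comment> \<open>The \<open>b\<close> in \<open>1 + b\<close> completes \<open>b * e\<close> to
    \<open>b * b ^ c\<close>: this is the carry. It leaves the digit 1 at position
    \<open>j = l - a\<close>, then \<open>c\<close> zeros; the multiple of \<open>b ^ a\<close> in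
    \<open>P\<close> only affects positions from \<open>l\<close> on.\<close>
  have sum: "n + b ^ (l - a) * (1 + b) * P = b ^ j * (1 + b * (b ^ c * (1 + k * (1 + b))))"
    unfolding n' P l a power_Suc e by (simp add: algebra_simps)
  have "radical_inverse b n = (1 - 1 / real b ^ c) / real b ^ (j + 1)"
    unfolding n radical_inverse_power_mult[OF assms(1)]
      radical_inverse_power_minus_one[OF assms(1)] ..
  also have "\<dots> = (real b ^ c - 1) / real b ^ l"
    unfolding l a using assms(1) by (simp add: power_add diff_divide_distrib)
  finally have 1: "radical_inverse b n = (real b ^ c - 1) / real b ^ l" .
  have "radical_inverse b (n + b ^ (l - a) * (1 + b) * P) = (real 1 + r / real b ^ c) / real b / real b ^ j"
    unfolding sum radical_inverse_power_mult[OF assms(1)] radical_inverse_digit[OF assms(1,1)]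
      r_def ..
  also have "\<dots> = (real b ^ c + r) / real b ^ l"
    unfolding l a using assms(1) by (simp add: power_add add_divide_distrib)
  finally have "radical_inverse b n - radical_inverse b (n + b ^ (l - a) * (1 + b) * P) =
      - (1 + r) / real b ^ l"
    unfolding 1 by (simp add: diff_divide_distrib add_divide_distrib)
  then show ?thesis
    using radical_inverse_bounds[OF assms(1), of "1 + k * (1 + b)"]
    by (simp add: r_def abs_divide divide_right_mono)
qed

section \<open>General bounds for the separation and covering radii\<close>

lemma separation_radius_le:
  assumes "i < j" "j < N"
  shows "separation_radius x N \<le> dist (x i) (x j) / 2"
proof -
  have "{dist (x i) (x j) |i j. i < j \<and> j < N} \<subseteq> (\<lambda>(i, j). dist (x i) (x j)) ` ({..<N} \<times> {..<N})"
    by auto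
  then have "finite {dist (x i) (x j) |i j. i < j \<and> j < N}"
    by (rule finite_subset) auto
  then show ?thesis
    unfolding separation_radius_def using assms by (auto intro!: Min_le)
qed

text \<open>The \<open>N\<close> closed balls of radius \<open>covering_radius x N\<close> around
  the points cover the unit cube, so their total volume is at least 1.\<close>

lemma covering_radius_lower_bound:
  fixes x :: "nat \<Rightarrow> real ^ 'd"
  assumes "N \<ge> 1"
  shows "covering_radius x N \<ge> 0"
    and "1 \<le> real N * (unit_ball_vol (real CARD('d)) * covering_radius x N ^ CARD('d))"
proof -
  let ?h = "covering_radius x N"
  let ?m = "\<lambda>y. Min ((\<lambda>i. dist y (x i)) ` {..<N})"
  have ne: "{..<N} \<noteq> {}" using assms by (auto simp: lessThan_empty_iff)
  have bdd: "bdd_above (?m ` cbox 0 1)"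
  proof -
    obtain K where K: "\<And>y. y \<in> cbox (0::real^'d) 1 \<Longrightarrow> norm y \<le> K"
      using bounded_cbox[of "0::real^'d" 1] unfolding bounded_iff by auto
    show ?thesis
    proof (rule bdd_aboveI2)
      fix y :: "real ^ 'd" assume y: "y \<in> cbox 0 1"
      have "?m y \<le> dist y (x 0)" using ne assms by (intro Min_le) auto
      also have "\<dots> \<le> norm y + norm (x 0)" by (simp add: dist_norm norm_triangle_ineq4)
      also have "\<dots> \<le> K + norm (x 0)" using K[OF y] by simp
      finally show "?m y \<le> K + norm (x 0)" .
    qed
  qed
  have upper: "?m y \<le> ?h" if "y \<in> cbox 0 1" for y
    unfolding covering_radius_def by (rule cSUP_upper[OF that bdd])
  have cover: "cbox 0 1 \<subseteq> (\<Union>i<N. cball (x i) ?h)"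
  proof
    fix y :: "real ^ 'd" assume y: "y \<in> cbox 0 1"
    have "?m y \<in> (\<lambda>i. dist y (x i)) ` {..<N}" using ne by (intro Min_in) auto
    then obtain i where "i < N" "?m y = dist y (x i)" by auto
    with upper[OF y] show "y \<in> (\<Union>i<N. cball (x i) ?h)" by (auto simp: dist_commute)
  qed
  have "(0::real^'d) \<in> cbox 0 1" by (simp add: mem_box_cart)
  then obtain i where "dist (x i) 0 \<le> ?h" using cover by auto
  then show h: "?h \<ge> 0" using zero_le_dist order_trans by blast
  have "(1::real) = measure lebesgue (cbox (0::real^'d) 1)"
    by (simp add: content_cbox_if_cart interval_eq_empty_cart)
  also have "\<dots> \<le> measure lebesgue (\<Union>i<N. cball (x i) ?h)"
    by (intro measure_mono_fmeasurable cover fmeasurable.finite_UN) (auto simp: lmeasurable_cball)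
  also have "\<dots> \<le> (\<Sum>i<N. measure lebesgue (cball (x i) ?h))"
    by (intro measure_UNION_le) auto
  also have "\<dots> = real N * (unit_ball_vol (real CARD('d)) * ?h ^ CARD('d))"
    using h by (simp add: content_cball)
  finally show "1 \<le> real N * (unit_ball_vol (real CARD('d)) * ?h ^ CARD('d))" .
qed

section \<open>Diophantine approximation and the choice of exponents\<close>

text \<open>Numbering \<open>I\<close> transfers the theorem to an arbitrary finite index set; it
  serves for the coordinates other than \<open>k\<close> and \<open>m\<close>.\<close>

lemma Dirichlet_approx_simult_finite:
  fixes \<theta> :: "'a \<Rightarrow> real"
  assumes "finite I" "N > 0"
  obtains q p where "0 < q" "q \<le> int (N ^ card I)"
    "\<And>i. i \<in> I \<Longrightarrow> \<bar>of_int q * \<theta> i - of_int (p i)\<bar> < 1 / real N"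
proof -
  obtain e where e: "bij_betw e I {0..<card I}"
    using ex_bij_betw_finite_nat[OF assms(1)] by blast
  obtain q p where "0 < q" "q \<le> int (N ^ card I)"
    and p: "\<And>i. i < card I \<Longrightarrow> \<bar>of_int q * \<theta> (inv_into I e i) - of_int (p i)\<bar> < 1 / N"
    using Dirichlet_approx_simult[OF assms(2), of "card I" "\<lambda>i. \<theta> (inv_into I e i)"] by metis
  moreover have "\<bar>of_int q * \<theta> i - of_int (p (e i))\<bar> < 1 / real N" if "i \<in> I" for i
    using p[of "e i"] that bij_betw_apply[OF e that] bij_betw_imp_inj_on[OF e] by simp
  ultimately show thesis by (intro that[of q "\<lambda>i. p (e i)"])
qed

text \<open>
  All exponents except \<open>l k\<close> are multiples of \<open>D = b k * totient (b k ^ a)\<close>, which gives the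
  congruences by Euler's theorem. Dirichlet's theorem for the ratios \<open>ln (b m) / ln (b i)\<close> with
  precision \<open>1 / D\<close> makes the powers \<open>b i ^ l i\<close> comparable although the exponents are this
  sparse; since there are only \<open>CARD('d) - 2\<close> ratios, \<open>l m\<close> stays below \<open>D ^ (CARD('d) - 1)\<close>.
  The factor \<open>b k\<close> in \<open>D\<close> is there to make \<open>D \<ge> b k ^ a\<close>.
\<close>

lemma exists_balanced_exponents:
  fixes b :: "'d::finite \<Rightarrow> nat"
  assumes b: "\<And>i. b i > 1" and cop: "\<And>i. i \<noteq> k \<Longrightarrow> coprime (b i) (b k)"
    and m: "m \<noteq> k" and a: "a \<ge> 1"
  obtains l :: "'d \<Rightarrow> nat"
  where "a \<le> l k"
    and "b k ^ a \<le> b m ^ l m"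
    and "l m \<le> (Max (range b) * b k ^ a) ^ (CARD('d) - 1)"
    and "b k ^ l k \<le> b m ^ l m"
    and "\<And>i. b m ^ l m \<le> Max (range b) * b i ^ l i"
    and "\<And>i. b i ^ l i \<le> Max (range b) * b m ^ l m"
    and "\<And>i. i \<noteq> k \<Longrightarrow> [b i ^ l i = 1] (mod b k ^ a)"
proof -
  define B where "B = Max (range b)"
  have B: "b i \<le> B" for i unfolding B_def by (intro Max_ge) auto
  then have B1: "1 \<le> B" using b[of k] by (meson less_imp_le order_trans)
  define D where "D = b k * totient (b k ^ a)"
  obtain a' where a': "a = Suc a'" using a by (cases a) auto
  have D_eq: "D = b k ^ a * totient (b k)"
    unfolding D_def a' totient_power_Suc by simp
  have tot: "1 \<le> totient (b k)" using b[of k] by (simp add: Suc_leI)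
  have D_ge: "b k ^ a \<le> D" unfolding D_eq using tot by simp
  have D_le: "D \<le> B * b k ^ a"
    unfolding D_eq using order_trans[OF totient_le B[of k]] by simp
  have D_pos: "0 < D" using D_ge b[of k] by (metis gr0I le_0_eq less_imp_neq power_not_zero not_less_zero)
  define \<theta> where "\<theta> i = ln (real (b m)) / ln (real (b i))" for i
  obtain q :: int and p where q: "0 < q" "q \<le> int (D ^ card (UNIV - {k, m}))"
    and p: "\<And>i. i \<in> UNIV - {k, m} \<Longrightarrow> \<bar>of_int q * \<theta> i - of_int (p i)\<bar> < 1 / real D"
    using Dirichlet_approx_simult_finite[OF finite D_pos, of "UNIV - {k, m}" \<theta>] by blast
  define X where "X = b m ^ (D * nat q)"
  have "1 \<le> nat q" using q(1) by linarith
  then have Dq: "D \<le> D * nat q" by simp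
  \<comment> \<open>This lower bound is what later forces \<open>a \<le> l k\<close>.\<close>
  have X_ge: "b k ^ a \<le> X"
  proof -
    have "b k ^ a \<le> 2 ^ D" using D_ge less_exp[of D] by linarith
    also have "\<dots> \<le> b m ^ D" using b[of m] by (intro power_mono) auto
    also have "\<dots> \<le> X" unfolding X_def using Dq b[of m] by (intro power_increasing) auto
    finally show ?thesis .
  qed
  have X1: "1 \<le> X" unfolding X_def using b[of m] by simp
  \<comment> \<open>The exponent at \<open>k\<close> is subject to no congruence, so the largest
    power of \<open>b k\<close> up to \<open>X\<close> serves.\<close>
  obtain l0 where l0: "b k ^ l0 \<le> X" "X < b k ^ (l0 + 1)"
    using ex_power_ivl1[of "b k" X] b[of k] X1 by auto
  define l where "l i = (if i = k then l0 else if i = m then D * nat q else D * nat (p i))" for i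
  have lm: "l m = D * nat q" "b m ^ l m = X" unfolding l_def X_def using m by auto
  have lk: "l k = l0" unfolding l_def by simp
  have main: "X \<le> B * b i ^ l i \<and> b i ^ l i \<le> B * X" for i
  proof -
    consider "i = k" | "i = m" | "i \<in> UNIV - {k, m}" by blast
    then show ?thesis
    proof cases
      case 1
      have "X \<le> b k * b k ^ l0" using l0(2) by simp
      also have "\<dots> \<le> B * b k ^ l0" using B by simp
      finally have "X \<le> B * b k ^ l0" .
      moreover have "b k ^ l0 \<le> B * X"
        using mult_le_mono[OF B1 l0(1)] by simp
      ultimately show ?thesis unfolding 1 lk by blast
    next
      case 2
      then show ?thesis using B1 lm(2) by simp
    next
      case 3
      have ln_pos: "0 < ln (real (b i))" "0 < ln (real (b m))" using b by (auto simp: ln_gt_zero)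
      \<comment> \<open>The integer \<open>p i\<close> is within distance 1 of a positive number,
        hence nonnegative, and \<open>nat (p i)\<close> loses nothing.\<close>
      have "0 < \<theta> i" unfolding \<theta>_def using ln_pos by simp
      then have "0 < real_of_int q * \<theta> i" using q(1) by simp
      moreover have "1 / real D \<le> 1" using D_pos by simp
      ultimately have "real_of_int (p i) > -1" using p[OF 3] by linarith
      then have "p i \<ge> 0" by linarith
      then have lp: "real (l i) = real D * real_of_int (p i)" unfolding l_def using 3 by simp
      have lq: "real (D * nat q) = real D * real_of_int q" using q(1) by simp
      \<comment> \<open>Scaling the approximation error by \<open>D * ln (b i)\<close> turns it into
        the difference of \<open>ln X\<close> and \<open>ln (b i ^ l i)\<close>. Precision
        \<open>1 / D\<close> thus means agreement up to a factor \<open>b i\<close>.\<close>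
      have "real D * ln (real (b i)) * \<bar>of_int q * \<theta> i - of_int (p i)\<bar>
          < real D * ln (real (b i)) * (1 / real D)"
        using p[OF 3] D_pos ln_pos by (intro mult_strict_left_mono) auto
      also have "\<dots> = ln (real (b i))" using D_pos by simp
      also have "real D * ln (real (b i)) * \<bar>of_int q * \<theta> i - of_int (p i)\<bar> =
          \<bar>real D * ln (real (b i)) * (of_int q * \<theta> i - of_int (p i))\<bar>"
        using ln_pos by (simp add: abs_mult)
      also have "real D * ln (real (b i)) * (of_int q * \<theta> i - of_int (p i)) =
          real D * of_int q * ln (real (b m)) - real D * of_int (p i) * ln (real (b i))"
        unfolding \<theta>_def using ln_pos by (simp add: algebra_simps)
      also have "\<dots> = ln (real X) - ln (real (b i ^ l i))"
        unfolding X_def of_nat_power lp[symmetric] lq[symmetric]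
        using b by (simp add: ln_realpow)
      finally have "\<bar>ln (real X) - ln (real (b i ^ l i))\<bar> < ln (real (b i))" .
      then have "ln (real X) < ln (real (b i)) + ln (real (b i ^ l i))"
          "ln (real (b i ^ l i)) < ln (real (b i)) + ln (real X)" by linarith+
      moreover have "0 < b i ^ l i" "0 < b i" "0 < X" using b[of i] X1 by auto
      ultimately have "ln (real X) < ln (real (b i * b i ^ l i))"
          "ln (real (b i ^ l i)) < ln (real (b i * X))"
        by (simp_all add: ln_mult)
      then have "real X < real (b i * b i ^ l i)" "real (b i ^ l i) < real (b i * X)"
        using \<open>0 < b i ^ l i\<close> \<open>0 < b i\<close> \<open>0 < X\<close>
          ln_less_cancel_iff[of "real X" "real (b i * b i ^ l i)"]
          ln_less_cancel_iff[of "real (b i ^ l i)" "real (b i * X)"] by auto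
      then have "X \<le> b i * b i ^ l i" "b i ^ l i \<le> b i * X"
        unfolding of_nat_less_iff by simp_all
      then show ?thesis using mult_le_mono1[OF B[of i]] order_trans by blast
    qed
  qed
  show thesis
  proof (rule that[of l, folded B_def])
    have "b k ^ a < b k ^ (l0 + 1)" using X_ge l0(2) by linarith
    then have "a < l0 + 1" using b[of k] power_less_imp_less_exp by blast
    then show "a \<le> l k" unfolding lk by simp
    show "b k ^ a \<le> b m ^ l m" using X_ge lm(2) by simp
    show "b k ^ l k \<le> b m ^ l m" using l0(1) lm(2) lk by simp
    show "l m \<le> (B * b k ^ a) ^ (CARD('d) - 1)"
    proof -
      have card: "card (UNIV - {k, m}) = CARD('d) - 2"
        using m by (subst card_Diff_subset) auto
      have "card {k, m} \<le> CARD('d)" by (intro card_mono) auto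
      then have c2: "Suc (CARD('d) - 2) = CARD('d) - 1" using m by simp
      have "nat q \<le> D ^ (CARD('d) - 2)" using q(2) unfolding card nat_le_iff .
      then have "l m \<le> D * D ^ (CARD('d) - 2)" using lm(1) by simp
      also have "\<dots> = D ^ (CARD('d) - 1)" by (metis c2 power_Suc)
      also have "\<dots> \<le> (B * b k ^ a) ^ (CARD('d) - 1)" by (intro power_mono D_le) auto
      finally show ?thesis .
    qed
    show "b m ^ l m \<le> B * b i ^ l i" "b i ^ l i \<le> B * b m ^ l m" for i
      using main[of i] lm(2) by auto
    show "[b i ^ l i = 1] (mod b k ^ a)" if "i \<noteq> k" for i
    proof -
      have "l i = totient (b k ^ a) * (b k * (if i = m then nat q else nat (p i)))"
        using that unfolding l_def D_def by simp
      moreover have "[b i ^ totient (b k ^ a) = 1] (mod b k ^ a)"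
        using cop[OF that] by (intro euler_theorem) simp
      ultimately show ?thesis using cong_pow by (metis power_mult power_one)
    qed
  qed
qed

section \<open>Close pairs of Halton points\<close>

text \<open>Coordinate \<open>k\<close> is handled by the carry, every other one by divisibility of
  \<open>M\<close> by \<open>b i ^ l i\<close>; the Euclidean norm is at most the sum of the
  coordinates' absolute values.\<close>

lemma dist_halton_le:
  fixes b l :: "'d::finite \<Rightarrow> nat"
  assumes b: "\<And>i. b i > 1" and a: "1 \<le> a" "a \<le> l k"
    and cong: "\<And>i. i \<noteq> k \<Longrightarrow> [b i ^ l i = 1] (mod b k ^ a)"
  defines "n \<equiv> b k ^ l k - b k ^ (l k - a + 1)"
    and "M \<equiv> b k ^ (l k - a) * (1 + b k) * (\<Prod>i\<in>UNIV - {k}. b i ^ l i)"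
  shows "dist (halton b n) (halton b (n + M)) \<le> (\<Sum>i\<in>UNIV. 2 / real (b i ^ l i))"
proof -
  let ?P = "\<Prod>i\<in>UNIV - {k}. b i ^ l i"
  have P1: "?P \<ge> 1"
    using b by (intro prod_ge_1 one_le_power) (simp add: less_imp_le)
  have P: "[?P = 1] (mod b k ^ a)"
    using cong_prod[of "UNIV - {k}" "\<lambda>i. b i ^ l i" "\<lambda>_. 1" "b k ^ a"] cong by simp
  have coord: "\<bar>radical_inverse (b i) n - radical_inverse (b i) (n + M)\<bar> \<le> 2 / real (b i ^ l i)" for i
  proof (cases "i = k")
    case True
    then show ?thesis
      using radical_inverse_carry[OF b a P P1] unfolding n_def M_def by simp
  next
    case False
    then have "b i ^ l i dvd M"
      unfolding M_def by (intro dvd_mult dvd_prodI) auto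
    then have "[n = n + M] (mod b i ^ l i)"
      by (simp add: cong_def mod_add_eq[symmetric, of n M])
    from radical_inverse_cong[OF b this]
    have "\<bar>radical_inverse (b i) n - radical_inverse (b i) (n + M)\<bar> \<le> 1 / real (b i ^ l i)" by simp
    also have "\<dots> \<le> 2 / real (b i ^ l i)" by (simp add: divide_right_mono)
    finally show ?thesis .
  qed
  have "dist (halton b n) (halton b (n + M)) \<le>
      (\<Sum>i\<in>UNIV. \<bar>(halton b n - halton b (n + M)) $ i\<bar>)"
    unfolding dist_norm by (rule norm_le_l1_cart)
  also have "\<dots> \<le> (\<Sum>i\<in>UNIV. 2 / real (b i ^ l i))"
    by (intro sum_mono) (use coord in \<open>simp add: halton_def\<close>)
  finally show ?thesis .
qed

text \<open>\<open>X\<close> is the common size of the powers \<open>b i ^ l i\<close> and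
  \<open>T = b k ^ a\<close> is the saving. The clause \<open>a < N\<close> provides infinitely many
  \<open>N\<close>.\<close>

lemma exists_small_separation:
  fixes b :: "'d::finite \<Rightarrow> nat"
  assumes b: "\<And>i. b i > 1" and cop: "\<And>i. i \<noteq> k \<Longrightarrow> coprime (b i) (b k)" and m: "m \<noteq> k"
  obtains C :: real where "C \<ge> 1"
    "\<And>a. a \<ge> 1 \<Longrightarrow> \<exists>N X T. a < N \<and> X \<ge> 1 \<and> T \<ge> 1 \<and> separation_radius (halton b) N \<le> C / X \<and>
       real N * T \<le> C * X ^ CARD('d) \<and> ln (real N) \<le> C * T ^ (CARD('d) - 1)"
proof -
  let ?d = "CARD('d)"
  define B where "B = Max (range b)"
  have B: "b i \<le> B" for i unfolding B_def by (intro Max_ge) auto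
  then have B1: "1 \<le> B" using b[of k] by (meson less_imp_le order_trans)
  \<comment> \<open>The first summand bounds \<open>N * T / X ^ d\<close>, the first two together
    bound \<open>ln N / T ^ (d - 1)\<close>, and the last bounds \<open>X\<close> times the
    separation radius.\<close>
  define C :: real where "C = 6 * real B ^ (?d + 1) + real ?d * real B ^ ?d + real ?d * real B"
  have C: "6 * real B ^ (?d + 1) + real ?d * real B ^ ?d \<le> C" "real ?d * real B \<le> C"
      "6 * real B ^ (?d + 1) \<le> C"
    unfolding C_def by simp_all
  have C1: "C \<ge> 1"
    using C(3) one_le_power[of "real B" "?d + 1"] B1 by simp
  show thesis
  proof (rule that[OF C1])
    fix a :: nat assume a: "a \<ge> 1"
    obtain l where l: "a \<le> l k" "b k ^ a \<le> b m ^ l m"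
        "l m \<le> (B * b k ^ a) ^ (?d - 1)" "b k ^ l k \<le> b m ^ l m"
        "\<And>i. b m ^ l m \<le> B * b i ^ l i" "\<And>i. b i ^ l i \<le> B * b m ^ l m"
        "\<And>i. i \<noteq> k \<Longrightarrow> [b i ^ l i = 1] (mod b k ^ a)"
      using exists_balanced_exponents[of b k m a, OF b cop m a] unfolding B_def by metis
    define X where "X = b m ^ l m"
    define T where "T = b k ^ a"
    define n where "n = b k ^ l k - b k ^ (l k - a + 1)"
    define P where "P = (\<Prod>i\<in>UNIV - {k}. b i ^ l i)"
    define M where "M = b k ^ (l k - a) * (1 + b k) * P"
    \<comment> \<open>The least number of points that includes both indices \<open>n\<close> and
      \<open>n + M\<close>.\<close>
    define N where "N = n + M + 1"
    have X1: "1 \<le> X" and T1: "1 \<le> T"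
      unfolding X_def T_def using b[of m] b[of k] by simp_all
    have pos: "b i ^ l i > 0" for i using b[of i] by simp
    \<comment> \<open>As \<open>m \<noteq> k\<close>, the power \<open>X\<close> is a factor of
      \<open>P\<close>. Hence \<open>n \<le> X \<le> M\<close>, and \<open>N\<close> has the order
      of \<open>M\<close>.\<close>
    have "X dvd P" unfolding X_def P_def using m by (intro dvd_prodI) auto
    moreover have "P > 0" unfolding P_def using pos by (intro prod_pos) auto
    ultimately have "X \<le> P" by (intro dvd_imp_le)
    also have "P \<le> M" unfolding M_def using b[of k] by (simp add: Suc_le_eq)
    finally have XM: "X \<le> M" .
    have "n \<le> X" unfolding n_def X_def using l(4) by simp
    then have N3: "N \<le> 3 * M" unfolding N_def using XM X1 by simp
    have "a < T" unfolding T_def using b[of k] by (intro power_gt_expt) simp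
    also have "T \<le> X" unfolding T_def X_def by (rule l(2))
    finally have aN: "a < N" unfolding N_def using XM by simp
    have "separation_radius (halton b) N \<le> dist (halton b n) (halton b (n + M)) / 2"
      unfolding N_def using XM X1 by (intro separation_radius_le) auto
    also have "\<dots> \<le> (\<Sum>i\<in>UNIV. 2 / real (b i ^ l i)) / 2"
      unfolding n_def M_def P_def using dist_halton_le[of b a l k, OF b a l(1) l(7)]
      by (intro divide_right_mono) auto
    also have "\<dots> = (\<Sum>i\<in>UNIV. 1 / real (b i ^ l i))"
      unfolding sum_divide_distrib by simp
    also have "\<dots> \<le> (\<Sum>i\<in>(UNIV::'d set). real B / real X)"
    proof (intro sum_mono)
      fix i
      have "real X \<le> real B * real (b i ^ l i)"
        using l(5)[of i] unfolding X_def of_nat_mult[symmetric] of_nat_le_iff .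
      then show "1 / real (b i ^ l i) \<le> real B / real X"
        using X1 pos[of i] by (simp add: divide_simps)
    qed
    also have "\<dots> = real ?d * real B / real X" by simp
    also have "\<dots> \<le> C / real X" using C(2) by (intro divide_right_mono) auto
    finally have sep: "separation_radius (halton b) N \<le> C / real X" .
    \<comment> \<open>Here the saving appears: \<open>M * T\<close>, not \<open>M\<close>, is
      \<open>1 + b k\<close> times the product of all the powers \<open>b i ^ l i\<close>.\<close>
    have "M * T = (1 + b k) * (b k ^ l k * P)"
    proof -
      have "b k ^ l k = b k ^ (l k - a) * T"
        unfolding T_def power_add[symmetric] using l(1) by simp
      then show ?thesis unfolding M_def by (simp add: algebra_simps)
    qed
    also have "\<dots> \<le> (1 + b k) * (B * X) ^ ?d"
    proof (intro mult_left_mono)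
      have "b k ^ l k * P = (\<Prod>i\<in>UNIV. b i ^ l i)"
        unfolding P_def by (simp add: prod.remove[of UNIV k])
      also have "\<dots> \<le> (\<Prod>i\<in>(UNIV::'d set). B * X)"
        unfolding X_def by (intro prod_mono) (use l(6) in auto)
      finally show "b k ^ l k * P \<le> (B * X) ^ ?d" by simp
    qed simp
    also have "\<dots> \<le> 2 * B * (B * X) ^ ?d" using B[of k] B1 by (intro mult_right_mono) auto
    finally have MT: "M * T \<le> 2 * B * (B * X) ^ ?d" .
    have "N * T \<le> 3 * (M * T)" using N3 by simp
    also have "\<dots> \<le> 6 * B ^ (?d + 1) * X ^ ?d"
      using MT by (simp add: power_mult_distrib ac_simps)
    finally have "real (N * T) \<le> real (6 * B ^ (?d + 1) * X ^ ?d)"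
      unfolding of_nat_le_iff .
    then have NT: "real N * real T \<le> 6 * real B ^ (?d + 1) * real X ^ ?d" by simp
    have NTC: "real N * real T \<le> C * real X ^ ?d"
      using NT mult_right_mono[OF C(3), of "real X ^ ?d"] by simp
    have N0: "real N > 0" unfolding N_def by simp
    have "real N \<le> real N * real T" using mult_left_mono[of 1 "real T" "real N"] T1 by simp
    then have "real N \<le> 6 * real B ^ (?d + 1) * real X ^ ?d" using NT by linarith
    then have "ln (real N) \<le> ln (6 * real B ^ (?d + 1) * real X ^ ?d)"
      using N0 by (rule ln_mono)
    \<comment> \<open>Since \<open>X = b m ^ l m\<close>, its logarithm is linear in
      \<open>l m\<close>, which is at most \<open>(B * T) ^ (d - 1)\<close>.\<close>
    also have "\<dots> = ln (6 * real B ^ (?d + 1)) + real ?d * (real (l m) * ln (real (b m)))"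
      using B1 X1 b[of m] by (simp add: ln_mult ln_realpow X_def del: power_Suc)
    also have "\<dots> \<le> 6 * real B ^ (?d + 1) + real ?d * ((real B * real T) ^ (?d - 1) * real B)"
    proof (intro add_mono mult_left_mono mult_mono)
      show "ln (6 * real B ^ (?d + 1)) \<le> 6 * real B ^ (?d + 1)"
        using B1 by (intro ln_bound) auto
      have "real (l m) \<le> real ((B * T) ^ (?d - 1))"
        unfolding of_nat_le_iff T_def by (rule l(3))
      then show "real (l m) \<le> (real B * real T) ^ (?d - 1)" by simp
      have "ln (real (b m)) \<le> real (b m)" using b[of m] by (intro ln_bound) auto
      then show "ln (real (b m)) \<le> real B" using B[of m] by simp
      show "0 \<le> ln (real (b m))" using b[of m] by simp
    qed auto
    also have "(real B * real T) ^ (?d - 1) * real B = real B ^ ?d * real T ^ (?d - 1)"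
      by (simp add: power_mult_distrib power_eq_if[of "real B" ?d])
    also have "6 * real B ^ (?d + 1) + real ?d * (real B ^ ?d * real T ^ (?d - 1)) \<le>
        6 * real B ^ (?d + 1) * real T ^ (?d - 1) + real ?d * (real B ^ ?d * real T ^ (?d - 1))"
      using mult_left_mono[OF one_le_power[of "real T" "?d - 1"], of "6 * real B ^ (?d + 1)"] T1
      by simp
    also have "\<dots> = (6 * real B ^ (?d + 1) + real ?d * real B ^ ?d) * real T ^ (?d - 1)"
      by (simp add: algebra_simps)
    also have "\<dots> \<le> C * real T ^ (?d - 1)" using C(1) by (intro mult_right_mono) auto
    finally have "ln (real N) \<le> C * real T ^ (?d - 1)" .
    with aN sep NTC X1 T1 show "\<exists>N X T. a < N \<and> X \<ge> 1 \<and> T \<ge> 1 \<and>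
        separation_radius (halton b) N \<le> C / X \<and>
        real N * T \<le> C * X ^ ?d \<and> ln (real N) \<le> C * T ^ (?d - 1)"
      by (metis of_nat_1 of_nat_le_iff)
  qed
qed

section \<open>From the parameters to the rate in \<open>N\<close>, and the mesh ratio\<close>

text \<open>Eliminates \<open>T\<close>: the logarithmic bound makes \<open>T\<close> at least of
  order \<open>ln N powr (1 / (d - 1))\<close>. Inserting this into
  \<open>N * T \<le> C * X ^ d\<close> and taking \<open>d\<close>-th roots gives the claim.\<close>

lemma powr_log_bound:
  fixes C X T N :: real and d :: nat
  assumes d: "d \<ge> 2" and "C \<ge> 1" "X \<ge> 1" "T \<ge> 1" "N > 1"
    and NT: "N * T \<le> C * X ^ d" and ln: "ln N \<le> C * T ^ (d - 1)"
  shows "N powr (1 / real d) * ln N powr (1 / (real d * (real d - 1))) \<le> C\<^sup>2 * X"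
proof -
  have d1: "real (d - 1) = real d - 1" "real d - 1 \<ge> 1" using d by auto
  have "ln N powr (1 / (real d - 1)) \<le> (C * T powr (real d - 1)) powr (1 / (real d - 1))"
    using ln powr_realpow[of T "d - 1"] assms(4,5) d1 by (intro powr_mono2) auto
  also have "\<dots> = C powr (1 / (real d - 1)) * T"
    using assms d1 by (simp add: powr_mult powr_powr)
  also have "C powr (1 / (real d - 1)) \<le> C powr 1"
    using assms d1 by (intro powr_mono) (auto simp: divide_le_eq)
  finally have "ln N powr (1 / (real d - 1)) \<le> C * T"
    using assms by (simp add: mult_right_mono)
  then have "N * ln N powr (1 / (real d - 1)) \<le> N * (C * T)"
    using assms by (intro mult_left_mono) auto
  also have "\<dots> = C * (N * T)" by simp
  also have "\<dots> \<le> C * (C * X ^ d)" using NT assms by (intro mult_left_mono) auto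
  also have "\<dots> = C\<^sup>2 * X ^ d" by (simp add: power2_eq_square)
  also have "\<dots> \<le> (C\<^sup>2 * X) ^ d"
    unfolding power_mult_distrib using assms by (intro mult_right_mono self_le_power) auto
  also have "\<dots> = (C\<^sup>2 * X) powr real d" using assms by (simp add: powr_realpow)
  finally have "(N * ln N powr (1 / (real d - 1))) powr (1 / real d) \<le>
      ((C\<^sup>2 * X) powr real d) powr (1 / real d)"
    using assms by (intro powr_mono2) auto
  also have "\<dots> = C\<^sup>2 * X" using assms d1 by (simp add: powr_powr)
  also have "(N * ln N powr (1 / (real d - 1))) powr (1 / real d) =
      N powr (1 / real d) * ln N powr (1 / (real d * (real d - 1)))"
    using assms d1 by (simp add: powr_mult powr_powr mult.commute)
  finally show ?thesis .
qed

text \<open>The covering radius is at least of order \<open>N powr (-1 / d)\<close>, so along the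
  given \<open>N\<close> the mesh ratio would grow like \<open>ln N powr e\<close>.\<close>

lemma not_quasi_uniform:
  fixes x :: "nat \<Rightarrow> real ^ 'd"
  assumes inf: "infinite {N::nat. N \<ge> 2 \<and>
      separation_radius x N \<le> c / (real N powr (1 / real CARD('d)) * ln (real N) powr e)}"
    and e: "e > 0"
  shows "\<not> quasi_uniform x"
proof
  let ?d = "CARD('d)"
  assume "quasi_uniform x"
  then obtain K where K: "K > 0" and sep: "\<And>N. N \<ge> 2 \<Longrightarrow> separation_radius x N > 0"
      "\<And>N. N \<ge> 2 \<Longrightarrow> covering_radius x N / separation_radius x N \<le> K"
    unfolding quasi_uniform_def by auto
  define V where "V = unit_ball_vol (real ?d)"
  have V: "V > 0" unfolding V_def by simp
  have "filterlim (\<lambda>N::nat. ln (real N) powr e) at_top at_top"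
    using e by real_asymp
  then have "eventually (\<lambda>N::nat. ln (real N) powr e > V powr (1 / real ?d) * (K * c)) at_top"
    unfolding filterlim_at_top_dense by blast
  then obtain N0 where N0: "\<And>N. N \<ge> N0 \<Longrightarrow>
      ln (real N) powr e > V powr (1 / real ?d) * (K * c)"
    unfolding eventually_sequentially by blast
  obtain N where N: "N \<ge> N0" "N \<ge> 2"
      "separation_radius x N \<le> c / (real N powr (1 / real ?d) * ln (real N) powr e)"
    using inf unfolding infinite_nat_iff_unbounded_le by blast
  define h where "h = covering_radius x N"
  have h: "h \<ge> 0" "1 \<le> real N * (V * h ^ ?d)"
    unfolding h_def V_def using covering_radius_lower_bound[of N x] N(2) by auto
  \<comment> \<open>Radius 0 would make the covering volume 0.\<close>
  then have h0: "h > 0" by (cases "h = 0") (auto simp: power_0_left)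
  have "h \<le> K * separation_radius x N"
    using sep(1,2)[OF N(2)] unfolding h_def by (simp add: divide_le_eq)
  also have "\<dots> \<le> K * (c / (real N powr (1 / real ?d) * ln (real N) powr e))"
    using N(3) K by (intro mult_left_mono) auto
  finally have "h * (real N powr (1 / real ?d) * ln (real N) powr e) \<le> K * c"
    using N(2) by (simp add: pos_le_divide_eq)
  then have *: "V powr (1 / real ?d) * (h * (real N powr (1 / real ?d) * ln (real N) powr e))
      \<le> V powr (1 / real ?d) * (K * c)"
    by (intro mult_left_mono) auto
  have "1 \<le> (real N * (V * h ^ ?d)) powr (1 / real ?d)"
    using h(2) by (intro ge_one_powr_ge_zero) auto
  also have "\<dots> = real N powr (1 / real ?d) * (V powr (1 / real ?d) * h)"
  proof -
    have "(h ^ ?d) powr (1 / real ?d) = (h powr real ?d) powr (1 / real ?d)"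
      using h0 by (simp add: powr_realpow)
    also have "\<dots> = h" using h0 by (simp add: powr_powr)
    finally show ?thesis using V h0 by (simp add: powr_mult)
  qed
  finally have "ln (real N) powr e \<le>
      real N powr (1 / real ?d) * (V powr (1 / real ?d) * h) * ln (real N) powr e"
    using mult_right_mono[of 1 _ "ln (real N) powr e"] by simp
  also have "\<dots> \<le> V powr (1 / real ?d) * (K * c)"
    using * by (simp add: ac_simps)
  finally show False using N0[OF N(1)] by simp
qed

theorem theorem2p1:
  fixes b :: "'d::{finite,linorder} \<Rightarrow> nat"
  assumes "CARD('d) \<ge> 2"
    and "\<forall>i. 1 < b i"
    and "strict_mono b"
    and "pairwise (\<lambda>i j. coprime (b i) (b j)) UNIV"
  shows "(\<exists>c>0. infinite {N::nat. N \<ge> 2 \<and>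
            separation_radius (halton b) N
              \<le> c / (real N powr (1 / real CARD('d)) *
                     ln (real N) powr (1 / (real CARD('d) * (real CARD('d) - 1))))})
         \<and> \<not> quasi_uniform (halton b)"
proof -
  let ?d = "CARD('d)"
  let ?f = "\<lambda>N. real N powr (1 / real ?d) * ln (real N) powr (1 / (real ?d * (real ?d - 1)))"
  \<comment> \<open>The carry takes place in coordinate \<open>k\<close>, and \<open>m\<close> sets
    the scale \<open>X\<close>.\<close>
  obtain k m :: 'd where m: "m \<noteq> k"
    using assms(1) by (metis card_2_iff' card_le_Suc0_iff_eq finite not_less_eq_eq numeral_2_eq_2 UNIV_I)
  have b: "1 < b i" for i using assms(2) by blast
  have cop: "coprime (b i) (b k)" if "i \<noteq> k" for i
    using assms(4) that by (simp add: pairwise_def)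
  obtain C :: real where C: "C \<ge> 1" and small: "\<And>a. a \<ge> 1 \<Longrightarrow>
      \<exists>N X T. a < N \<and> X \<ge> 1 \<and> T \<ge> 1 \<and> separation_radius (halton b) N \<le> C / X \<and>
        real N * T \<le> C * X ^ ?d \<and> ln (real N) \<le> C * T ^ (?d - 1)"
    using exists_small_separation[of b k m, OF b cop m] by metis
  \<comment> \<open>The exponent 3 combines \<open>C / X\<close> with
    \<open>?f N \<le> C\<^sup>2 * X\<close>.\<close>
  have inf: "infinite {N::nat. N \<ge> 2 \<and> separation_radius (halton b) N \<le> C ^ 3 / ?f N}"
    unfolding infinite_nat_iff_unbounded_le
  proof
    fix a
    \<comment> \<open>\<open>Suc a\<close> meets the requirement of being at least 1 and yields
      \<open>N \<ge> 2\<close>, so that \<open>ln N > 0\<close>.\<close>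
    obtain N X T where N: "Suc a < N" and XT: "X \<ge> 1" "T \<ge> 1"
      and sep: "separation_radius (halton b) N \<le> C / X"
      and NT: "real N * T \<le> C * X ^ ?d" "ln (real N) \<le> C * T ^ (?d - 1)"
      using small[of "Suc a"] by auto
    have "?f N \<le> C\<^sup>2 * X"
      using N by (intro powr_log_bound[OF assms(1) C XT _ NT]) simp
    moreover have "?f N > 0" using N by simp
    ultimately have "C ^ 3 / (C\<^sup>2 * X) \<le> C ^ 3 / ?f N"
      using C by (intro divide_left_mono) auto
    moreover have "C ^ 3 / (C\<^sup>2 * X) = C / X"
      using C by (simp add: power2_eq_square power3_eq_cube)
    ultimately show "\<exists>N\<ge>a. N \<in> {N. N \<ge> 2 \<and> separation_radius (halton b) N \<le> C ^ 3 / ?f N}"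
      using sep N by (intro exI[of _ N]) auto
  qed
  have "\<not> quasi_uniform (halton b)"
    by (rule not_quasi_uniform[OF inf]) (use assms(1) in simp)
  moreover have "C ^ 3 > 0" using C by simp
  ultimately show ?thesis using inf by blast
qed

end
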